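(* Let $G=(V,E)$ be a connected locally finite graph. If $\mathrm{DN}_{\mathrm{LLY}}(G)<\infty$, then either $G=C_n$ (the cycle of length $n$) for some $n\ge 6$, or the tree-like skeleton $\mathcal S(G)$ is a forest.
   Context: Graphs are simple and undirected; $G$ may be infinite but is locally finite. Let $d(\cdot,\cdot)$ be the combinatorial graph distance. For a positive edge weight $w:E\to(0,\infty)$ put $d_x^w:=\sum_{y\sim x}w_{xy}$. For $\alpha\in[0,1]$ let $\mu_x^{\alpha,w}$ be the probability measure with $\mu_x^{\alpha,w}(x)=\alpha$, $\mu_x^{\alpha,w}(z)=(1-\alpha)w_{xz}/d_x^w$ for $z\sim x$, and $0$ otherwise. Let $W_1$ be the $1$-Wasserstein distance with respect to $d$. For $x\sim y$ let $\kappa_\alpha^w(x,y):=1-W_1(\mu_x^{\alpha,w},\mu_y^{\alpha,w})$ and define the weighted Lin--Lu--Yau curvature $\kappa_{\mathrm{LLY}}^w(x,y):=\lim_{\alpha\to1^-}\kappa_\alpha^w(x,y)/(1-\alpha)$. For connected locally finite $G$ with $E\neq\varnothing$: $\mathrm{Dist}(w):=\sup_{e\in E}w_e/\inf_{e\in E}w_e$, with value $+\infty$ if the supremum is infinite or the infimum is $0$; a positive weight $w$ is admissible if $\kappa_{\mathrm{LLY}}^w(e)\ge0$ for every $e\in E$; and $\mathrm{DN}_{\mathrm{LLY}}(G):=\inf\{\mathrm{Dist}(w): w \text{ admissible}\}$, with value $+\infty$ if no admissible weight has finite distortion. By convention $\mathrm{DN}_{\mathrm{LLY}}(K_1)=1$.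 An edge is tree-like in $G$ if it lies on no cycle of $G$ of length $3$, $4$ or $5$; $E_{\mathrm{tl}}(G)$ is the set of tree-like edges, and the tree-like skeleton is $\mathcal S(G):=(V,E_{\mathrm{tl}}(G))$. *)

theory Defs
  imports "HOL-Probability.Probability_Mass_Function"
begin

section \<open>Simple undirected graphs\<close>

text \<open>Edges are two-element sets of vertices; neither set need be finite.\<close>

record 'a ugraph =
  verts :: "'a set"
  edges :: "'a set set"

definition simple_graph :: "'a ugraph \<Rightarrow> bool" where
  "simple_graph G \<longleftrightarrow> (\<forall>e\<in>edges G. e \<subseteq> verts G \<and> card e = 2)"

definition adj :: "'a ugraph \<Rightarrow> ('a \<times> 'a) set" where
  "adj G = {(x, y). {x, y} \<in> edges G}"

definition nbrs :: "'a ugraph \<Rightarrow> 'a \<Rightarrow> 'a set" where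
  "nbrs G x = {y. (x, y) \<in> adj G}"

definition locally_finite :: "'a ugraph \<Rightarrow> bool" where
  "locally_finite G \<longleftrightarrow> (\<forall>x\<in>verts G. finite (nbrs G x))"

definition connected_graph :: "'a ugraph \<Rightarrow> bool" where
  "connected_graph G \<longleftrightarrow> verts G \<noteq> {} \<and> (\<forall>x\<in>verts G. \<forall>y\<in>verts G. (x, y) \<in> (adj G)\<^sup>*)"

text \<open>The relational power \<open>adj G ^^ n\<close> relates the endpoints of walks of length \<open>n\<close>.
  The value is meaningful only if \<open>x\<close> and \<open>y\<close> are joined by a walk.\<close>

definition graph_dist :: "'a ugraph \<Rightarrow> 'a \<Rightarrow> 'a \<Rightarrow> nat" where
  "graph_dist G x y = (LEAST n. (x, y) \<in> adj G ^^ n)"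

text \<open>A cycle is given by the list of its distinct vertices in cyclic order;
  its length is the length of the list.\<close>

definition cycle_edges :: "'a list \<Rightarrow> 'a set set" where
  "cycle_edges c = (\<lambda>i. {c ! i, c ! (Suc i mod length c)}) ` {..<length c}"

definition is_cycle :: "'a ugraph \<Rightarrow> 'a list \<Rightarrow> bool" where
  "is_cycle G c \<longleftrightarrow> 3 \<le> length c \<and> distinct c \<and> cycle_edges c \<subseteq> edges G"

definition forest :: "'a ugraph \<Rightarrow> bool" where
  "forest G \<longleftrightarrow> \<not> (\<exists>c. is_cycle G c)"

definition graph_iso :: "'a ugraph \<Rightarrow> 'b ugraph \<Rightarrow> bool" where
  "graph_iso G H \<longleftrightarrow> (\<exists>f. bij_betw f (verts G) (verts H) \<and> (`) f ` edges G = edges H)"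

definition cycle_graph :: "nat \<Rightarrow> nat ugraph" where
  "cycle_graph n = \<lparr>verts = {..<n}, edges = cycle_edges [0..<n]\<rparr>"

section \<open>The tree-like skeleton\<close>

definition tree_like_edges :: "'a ugraph \<Rightarrow> 'a set set" where
  "tree_like_edges G =
    {e \<in> edges G. \<not> (\<exists>c. is_cycle G c \<and> length c \<in> {3, 4, 5} \<and> e \<in> cycle_edges c)}"

definition skeleton :: "'a ugraph \<Rightarrow> 'a ugraph" where
  "skeleton G = \<lparr>verts = verts G, edges = tree_like_edges G\<rparr>"

section \<open>Weighted Lin--Lu--Yau curvature\<close>

text \<open>An edge weight is a function on sets of vertices, of which only the values on
  \<open>edges G\<close> matter.\<close>

definition positive_weight :: "'a ugraph \<Rightarrow> ('a set \<Rightarrow> real) \<Rightarrow> bool" where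
  "positive_weight G w \<longleftrightarrow> (\<forall>e\<in>edges G. 0 < w e)"

definition wdeg :: "'a ugraph \<Rightarrow> ('a set \<Rightarrow> real) \<Rightarrow> 'a \<Rightarrow> real" where
  "wdeg G w x = (\<Sum>y\<in>nbrs G x. w {x, y})"

definition lazy_fun :: "'a ugraph \<Rightarrow> ('a set \<Rightarrow> real) \<Rightarrow> real \<Rightarrow> 'a \<Rightarrow> 'a \<Rightarrow> real" where
  "lazy_fun G w \<alpha> x z =
    (if z = x then \<alpha>
     else if z \<in> nbrs G x then (1 - \<alpha>) * w {x, z} / wdeg G w x
     else 0)"

text \<open>By \<open>pmf_lazy_walk\<close> below, \<open>lazy_fun\<close> is indeed the mass function of \<open>lazy_walk\<close>
  whenever \<open>x\<close> has a neighbour.\<close>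

definition lazy_walk :: "'a ugraph \<Rightarrow> ('a set \<Rightarrow> real) \<Rightarrow> real \<Rightarrow> 'a \<Rightarrow> 'a pmf" where
  "lazy_walk G w \<alpha> x = embed_pmf (lazy_fun G w \<alpha> x)"

definition couplings :: "'a pmf \<Rightarrow> 'b pmf \<Rightarrow> ('a \<times> 'b) pmf set" where
  "couplings p q = {\<pi>. map_pmf fst \<pi> = p \<and> map_pmf snd \<pi> = q}"

text \<open>A real-valued infimum suffices because \<open>W1\<close> is only applied to finitely supported
  measures, for which all transport costs are finite.\<close>

definition W1 :: "('a \<Rightarrow> 'a \<Rightarrow> real) \<Rightarrow> 'a pmf \<Rightarrow> 'a pmf \<Rightarrow> real" where
  "W1 d p q = (INF \<pi>\<in>couplings p q. measure_pmf.expectation \<pi> (\<lambda>(u, v). d u v))"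

definition kappa :: "'a ugraph \<Rightarrow> ('a set \<Rightarrow> real) \<Rightarrow> real \<Rightarrow> 'a \<Rightarrow> 'a \<Rightarrow> real" where
  "kappa G w \<alpha> x y =
    1 - W1 (\<lambda>u v. real (graph_dist G u v)) (lazy_walk G w \<alpha> x) (lazy_walk G w \<alpha> y)"

definition kappa_LLY :: "'a ugraph \<Rightarrow> ('a set \<Rightarrow> real) \<Rightarrow> 'a \<Rightarrow> 'a \<Rightarrow> real" where
  "kappa_LLY G w x y = Lim (at_left 1) (\<lambda>\<alpha>. kappa G w \<alpha> x y / (1 - \<alpha>))"

section \<open>Distortion\<close>

definition Dist :: "'a ugraph \<Rightarrow> ('a set \<Rightarrow> real) \<Rightarrow> ereal" where
  "Dist G w =
    (let s = (SUP e\<in>edges G. ereal (w e)); i = (INF e\<in>edges G. ereal (w e))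
     in if s = \<infinity> \<or> i = 0 then \<infinity> else s / i)"

definition admissible :: "'a ugraph \<Rightarrow> ('a set \<Rightarrow> real) \<Rightarrow> bool" where
  "admissible G w \<longleftrightarrow>
    positive_weight G w \<and> (\<forall>x y. {x, y} \<in> edges G \<longrightarrow> 0 \<le> kappa_LLY G w x y)"

text \<open>The infimum in \<open>ereal\<close> is \<open>\<infinity>\<close> if there is no admissible weight of finite distortion.
  The first case is the convention for the one-vertex graph.\<close>

definition DN_LLY :: "'a ugraph \<Rightarrow> ereal" where
  "DN_LLY G = (if card (verts G) = 1 then 1 else (INF w\<in>{w. admissible G w}. Dist G w))"

lemma pmf_lazy_walk:
  assumes G: "simple_graph G" "locally_finite G" and w: "positive_weight G w"
    and xy: "{x, y} \<in> edges G" and \<alpha>: "0 \<le> \<alpha>" "\<alpha> \<le> 1"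
  shows "pmf (lazy_walk G w \<alpha> x) z = lazy_fun G w \<alpha> x z"
proof -
  let ?N = "nbrs G x" and ?f = "lazy_fun G w \<alpha> x"
  have x: "x \<in> verts G" using G(1) xy by (auto simp: simple_graph_def)
  have fin: "finite ?N" using G(2) x by (auto simp: locally_finite_def)
  have xN: "x \<notin> ?N" using G(1) by (auto simp: simple_graph_def nbrs_def adj_def)
  have yN: "y \<in> ?N" using xy by (auto simp: nbrs_def adj_def)
  have pos: "0 < w {x, z}" if "z \<in> ?N" for z
    using that w by (auto simp: nbrs_def adj_def positive_weight_def)
  have deg: "0 < wdeg G w x"
    unfolding wdeg_def using fin yN pos by (intro sum_pos) auto
  have nonneg: "0 \<le> ?f z" for z
    using pos[of z] deg \<alpha> by (auto simp: lazy_fun_def)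
  have "(\<Sum>z\<in>?N. ?f z) = (\<Sum>z\<in>?N. (1 - \<alpha>) * w {x, z} / wdeg G w x)"
    using xN by (intro sum.cong) (auto simp: lazy_fun_def)
  also have "\<dots> = (1 - \<alpha>) * wdeg G w x / wdeg G w x"
    by (simp add: wdeg_def sum_distrib_left sum_divide_distrib)
  finally have "(\<Sum>z\<in>?N. ?f z) = 1 - \<alpha>" using deg by simp
  then have sum1: "(\<Sum>z\<in>insert x ?N. ?f z) = 1"
    using fin xN by (simp add: lazy_fun_def)
  have "(\<integral>\<^sup>+z. ennreal (?f z) \<partial>count_space UNIV) = (\<Sum>z\<in>insert x ?N. ennreal (?f z))"
    using fin by (intro nn_integral_count_space') (auto simp: lazy_fun_def)
  also have "\<dots> = 1"
    using nonneg sum1 by (simp add: sum_ennreal del: sum.insert)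
  finally show ?thesis
    unfolding lazy_walk_def using nonneg by (intro pmf_embed_pmf)
qed

end

theory Submission
  imports Defs
begin

text \<open>On a tree-like edge \<open>xy\<close> optimal transport has an explicit dual solution, so that
  \<open>\<kappa>(x,y) = 2 w\<^bsub>xy\<^esub>/d\<^sub>x + 2 w\<^bsub>xy\<^esub>/d\<^sub>y - 2\<close>. Around a cycle of \<open>n\<close> tree-like edges, nonnegative curvature
  therefore gives \<open>n \<le> \<Sum>\<^sub>e (w\<^sub>e/d\<^sub>x + w\<^sub>e/d\<^sub>y)\<close>. Regrouped by vertices, the right-hand side has
  one summand \<open>(w\<^sub>e + w\<^bsub>e'\<^esub>)/d\<^sub>v \<le> 1\<close> per vertex \<open>v\<close>, where \<open>e, e'\<close> are the cycle edges at \<open>v\<close>.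
  Equality holds throughout, every vertex of the cycle has degree two, and by connectedness the
  cycle is the whole graph.\<close>

section \<open>Walks around a tree-like edge\<close>

lemma adj_sym: "(x, y) \<in> adj G \<longleftrightarrow> (y, x) \<in> adj G"
  by (simp add: adj_def insert_commute)

lemma in_nbrs_iff: "y \<in> nbrs G x \<longleftrightarrow> (x, y) \<in> adj G"
  by (simp add: nbrs_def)

lemma adj_irrefl: "simple_graph G \<Longrightarrow> (x, x) \<notin> adj G"
  by (auto simp: simple_graph_def adj_def)

lemma graph_dist_le: "(u, v) \<in> adj G ^^ n \<Longrightarrow> graph_dist G u v \<le> n"
  unfolding graph_dist_def by (rule Least_le)

text \<open>The first hypothesis makes the \<open>LEAST\<close> in \<open>graph_dist\<close>
  attained, so the value is the length of an actual walk.\<close>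

lemma graph_dist_ge:
  assumes "(u, v) \<in> (adj G)\<^sup>*" and "\<And>m. m < k \<Longrightarrow> (u, v) \<notin> adj G ^^ m"
  shows "k \<le> graph_dist G u v"
proof -
  obtain n where "(u, v) \<in> adj G ^^ n" using assms(1) rtrancl_power by blast
  then have "(u, v) \<in> adj G ^^ graph_dist G u v" unfolding graph_dist_def by (rule LeastI)
  then show ?thesis using assms(2) not_le by blast
qed

lemma tree_like_not_in_short_cycle:
  "\<lbrakk>e \<in> tree_like_edges G; is_cycle G c; length c < 6\<rbrakk> \<Longrightarrow> e \<notin> cycle_edges c"
  by (auto simp: tree_like_edges_def is_cycle_def)

text \<open>A coincidence \<open>u = v\<close>, or a walk of length 1 or 2 from \<open>u\<close> to
  \<open>v\<close>, would close the path \<open>u\<close>, \<open>x\<close>, \<open>y\<close>,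
  \<open>v\<close> to a cycle of length 3, 4 or 5 through \<open>{x, y}\<close>. Hence
  \<open>u\<close> and \<open>v\<close> are at distance exactly 3.\<close>

lemma tree_like_no_short_walk:
  assumes G: "simple_graph G" and e: "{x, y} \<in> tree_like_edges G"
    and u: "(x, u) \<in> adj G" "u \<noteq> y" and v: "(y, v) \<in> adj G" "v \<noteq> x"
  shows "u \<noteq> v" "(u, v) \<notin> adj G" "(u, v) \<notin> adj G ^^ 2"
proof -
  have xy: "{x, y} \<in> edges G" "{y, x} \<in> edges G"
    using e by (auto simp: tree_like_edges_def insert_commute)
  have irr: "{a} \<notin> edges G" for a using adj_irrefl[OF G, of a] by (simp add: adj_def)
  have ne: "x \<noteq> y" "u \<noteq> x" "v \<noteq> y" using xy u v irr by (auto simp: adj_def)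
  have no3: "\<not> ((y, z) \<in> adj G \<and> (z, x) \<in> adj G)" for z
  proof
    assume z: "(y, z) \<in> adj G \<and> (z, x) \<in> adj G"
    then have "z \<noteq> x" "z \<noteq> y" using irr by (auto simp: adj_def)
    then have "is_cycle G [x, y, z]"
      using xy z ne by (auto simp: is_cycle_def cycle_edges_def adj_def lessThan_Suc)
    then show False using tree_like_not_in_short_cycle[OF e, of "[x, y, z]"]
      by (auto simp: cycle_edges_def lessThan_Suc)
  qed
  show uv: "u \<noteq> v" using no3 u v adj_sym by metis
  show nadj: "(u, v) \<notin> adj G"
  proof
    assume "(u, v) \<in> adj G"
    then have "is_cycle G [x, y, v, u]"
      using xy ne u v uv
      by (auto simp: is_cycle_def cycle_edges_def adj_def lessThan_Suc insert_commute)
    then show False using tree_like_not_in_short_cycle[OF e, of "[x, y, v, u]"]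
      by (auto simp: cycle_edges_def lessThan_Suc)
  qed
  show "(u, v) \<notin> adj G ^^ 2"
  proof
    assume "(u, v) \<in> adj G ^^ 2"
    then obtain t where t: "(u, t) \<in> adj G" "(t, v) \<in> adj G"
      by (auto simp: numeral_2_eq_2)
    \<comment> \<open>A 5-cycle needs \<open>t\<close> distinct from the other four vertices:
      \<open>t = x\<close> or \<open>t = y\<close> would put a triangle on \<open>{x, y}\<close>,
      and \<open>t = u\<close> or \<open>t = v\<close> would make \<open>u\<close> and
      \<open>v\<close> adjacent.\<close>
    have "t \<noteq> x" "t \<noteq> y" using no3 t u v adj_sym by metis+
    moreover have "t \<noteq> u" "t \<noteq> v" using t nadj by auto
    ultimately have "is_cycle G [x, y, v, t, u]"
      using xy ne u v uv t
      by (auto simp: is_cycle_def cycle_edges_def adj_def lessThan_Suc insert_commute)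
    then show False using tree_like_not_in_short_cycle[OF e, of "[x, y, v, t, u]"]
      by (auto simp: cycle_edges_def lessThan_Suc)
  qed
qed

lemma tree_like_no_triangle:
  assumes G: "simple_graph G" and e: "{x, y} \<in> tree_like_edges G" and z: "(x, z) \<in> adj G"
  shows "(y, z) \<notin> adj G"
  using tree_like_no_short_walk(1)[OF G e z _ _] adj_irrefl[OF G] z by metis

section \<open>Curvature of a tree-like edge\<close>

text \<open>Complementary slackness: under any coupling, the expectation of \<open>f u - f v\<close>
  depends only on the marginals. So \<open>lip\<close> bounds every cost from below, and
  \<open>tight\<close> makes \<open>\<pi>\<close> attain the bound.\<close>

lemma W1_eq_potential:
  fixes f :: "'a \<Rightarrow> real"
  assumes fin: "finite (set_pmf p)" "finite (set_pmf q)"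
    and lip: "\<And>u v. u \<in> set_pmf p \<Longrightarrow> v \<in> set_pmf q \<Longrightarrow> f u - f v \<le> d u v"
    and \<pi>: "\<pi> \<in> couplings p q"
    and tight: "\<And>u v. (u, v) \<in> set_pmf \<pi> \<Longrightarrow> d u v = f u - f v"
  shows "W1 d p q = measure_pmf.expectation p f - measure_pmf.expectation q f"
proof -
  have pot: "measure_pmf.expectation \<rho> (\<lambda>(u, v). f u - f v)
      = measure_pmf.expectation p f - measure_pmf.expectation q f"
    and fin\<rho>: "finite (set_pmf \<rho>)" and sub: "set_pmf \<rho> \<subseteq> set_pmf p \<times> set_pmf q"
    if \<rho>: "\<rho> \<in> couplings p q" for \<rho>
  proof -
    have pq: "p = map_pmf fst \<rho>" "q = map_pmf snd \<rho>" using \<rho> by (auto simp: couplings_def)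
    show sub: "set_pmf \<rho> \<subseteq> set_pmf p \<times> set_pmf q" by (force simp: pq)
    then show fin\<rho>: "finite (set_pmf \<rho>)" using fin finite_subset by blast
    show "measure_pmf.expectation \<rho> (\<lambda>(u, v). f u - f v)
      = measure_pmf.expectation p f - measure_pmf.expectation q f"
      unfolding pq integral_map_pmf case_prod_beta
      by (intro Bochner_Integration.integral_diff integrable_measure_pmf_finite fin\<rho>)
  qed
  show ?thesis
    unfolding W1_def
  proof (rule cInf_eq_minimum)
    have "measure_pmf.expectation \<pi> (\<lambda>(u, v). d u v)
        = measure_pmf.expectation \<pi> (\<lambda>(u, v). f u - f v)"
      by (intro integral_cong_AE) (auto simp: AE_measure_pmf_iff tight)
    then show "measure_pmf.expectation p f - measure_pmf.expectation q f
        \<in> (\<lambda>\<pi>. measure_pmf.expectation \<pi> (\<lambda>(u, v). d u v)) ` couplings p q"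
      using \<pi> pot[OF \<pi>] by force
  next
    fix c assume "c \<in> (\<lambda>\<pi>. measure_pmf.expectation \<pi> (\<lambda>(u, v). d u v)) ` couplings p q"
    then obtain \<rho> where \<rho>: "\<rho> \<in> couplings p q"
      and c: "c = measure_pmf.expectation \<rho> (\<lambda>(u, v). d u v)" by auto
    have "measure_pmf.expectation \<rho> (\<lambda>(u, v). f u - f v) \<le> c"
      unfolding c using sub[OF \<rho>]
      by (intro integral_mono_AE integrable_measure_pmf_finite fin\<rho>[OF \<rho>])
        (auto simp: AE_measure_pmf_iff intro!: lip)
    then show "measure_pmf.expectation p f - measure_pmf.expectation q f \<le> c"
      using pot[OF \<rho>] by simp
  qed
qed

lemma set_lazy_walk:
  assumes G: "simple_graph G" "locally_finite G" and w: "positive_weight G w"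
    and xy: "{x, y} \<in> edges G" and \<alpha>: "0 \<le> \<alpha>" "\<alpha> \<le> 1"
  shows "set_pmf (lazy_walk G w \<alpha> x) \<subseteq> insert x (nbrs G x)"
    and "\<alpha> = 0 \<Longrightarrow> set_pmf (lazy_walk G w \<alpha> x) \<subseteq> nbrs G x"
  unfolding set_pmf_eq pmf_lazy_walk[OF assms] by (auto simp: lazy_fun_def)

lemma wdeg_pos:
  assumes "simple_graph G" "locally_finite G" "positive_weight G w" "{x, y} \<in> edges G"
  shows "0 < wdeg G w x"
  unfolding wdeg_def using assms
  by (intro sum_pos) (auto simp: simple_graph_def locally_finite_def positive_weight_def
      nbrs_def adj_def)

text \<open>Made for a potential that is constant on the neighbours of one endpoint apart from the
  other endpoint; the weight then enters only through the share of \<open>{x, y}\<close> in the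
  degree.\<close>

lemma expectation_lazy_walk:
  fixes f :: "'a \<Rightarrow> real"
  assumes G: "simple_graph G" "locally_finite G" and w: "positive_weight G w"
    and xy: "{x, y} \<in> edges G" and \<alpha>: "0 \<le> \<alpha>" "\<alpha> \<le> 1"
    and f: "\<And>z. z \<in> nbrs G x \<Longrightarrow> z \<noteq> y \<Longrightarrow> f z = a"
  shows "measure_pmf.expectation (lazy_walk G w \<alpha> x) f
    = \<alpha> * f x + (1 - \<alpha>) * (a + (f y - a) * (w {x, y} / wdeg G w x))"
proof -
  let ?N = "nbrs G x"
  have fin: "finite ?N" using G xy by (auto simp: simple_graph_def locally_finite_def)
  have xN: "x \<notin> ?N" using adj_irrefl[OF G(1)] by (simp add: in_nbrs_iff)
  have yN: "y \<in> ?N" using xy by (simp add: in_nbrs_iff adj_def)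
  have deg: "wdeg G w x \<noteq> 0" using wdeg_pos[OF G w xy] by simp
  have "(\<Sum>z\<in>?N. f z * w {x, z}) = (\<Sum>z\<in>?N. a * w {x, z} + (if z = y then (f y - a) * w {x, y} else 0))"
    using f by (intro sum.cong) (auto simp: algebra_simps)
  also have "\<dots> = a * wdeg G w x + (f y - a) * w {x, y}"
    using fin yN by (simp add: sum.distrib wdeg_def sum_distrib_left)
  finally have s: "(\<Sum>z\<in>?N. f z * w {x, z}) = a * wdeg G w x + (f y - a) * w {x, y}" .
  have "measure_pmf.expectation (lazy_walk G w \<alpha> x) f
      = (\<Sum>z\<in>insert x ?N. f z * lazy_fun G w \<alpha> x z)"
    unfolding pmf_lazy_walk[OF G w xy \<alpha>, symmetric]
    using fin set_lazy_walk(1)[OF G w xy \<alpha>] by (intro integral_measure_pmf_real) auto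
  also have "\<dots> = \<alpha> * f x + (\<Sum>z\<in>?N. f z * lazy_fun G w \<alpha> x z)"
    using fin xN by (simp add: lazy_fun_def)
  also have "(\<Sum>z\<in>?N. f z * lazy_fun G w \<alpha> x z)
      = (\<Sum>z\<in>?N. (1 - \<alpha>) / wdeg G w x * (f z * w {x, z}))"
    using xN by (intro sum.cong) (auto simp: lazy_fun_def)
  also have "\<dots> = (1 - \<alpha>) / wdeg G w x * (a * wdeg G w x + (f y - a) * w {x, y})"
    by (simp only: sum_distrib_left[symmetric] s)
  also have "\<dots> = (1 - \<alpha>) * (a + (f y - a) * (w {x, y} / wdeg G w x))"
    using deg by (simp add: field_simps)
  finally show ?thesis .
qed

text \<open>Matches the lazy walk with the Bernoulli mixtures of the coupling below, which use only
  walks of idleness 0.\<close>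

lemma lazy_fun_mix: "lazy_fun G w \<alpha> x z = \<alpha> * indicator {x} z + (1 - \<alpha>) * lazy_fun G w 0 x z"
  by (simp add: lazy_fun_def)

text \<open>Send the mass \<open>1 - \<alpha>\<close> on the neighbours of \<open>x\<close> to \<open>y\<close>, the mass \<open>1 - \<alpha>\<close> on the
  neighbours of \<open>y\<close> comes from \<open>x\<close>, and the remaining \<open>2\<alpha> - 1 \<ge> 0\<close> moves from \<open>x\<close> to \<open>y\<close>.\<close>

lemma lazy_walk_coupling:
  assumes G: "simple_graph G" "locally_finite G" and w: "positive_weight G w"
    and xy: "{x, y} \<in> edges G" and \<alpha>: "1 / 2 \<le> \<alpha>" "\<alpha> \<le> 1"
  obtains \<pi> where "\<pi> \<in> couplings (lazy_walk G w \<alpha> x) (lazy_walk G w \<alpha> y)"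
    and "set_pmf \<pi> \<subseteq> insert (x, y) (nbrs G x \<times> {y} \<union> {x} \<times> nbrs G y)"
proof
  have yx: "{y, x} \<in> edges G" using xy by (simp add: insert_commute)
  define P where "P = lazy_walk G w 0"
  \<comment> \<open>The pair \<open>(x, y)\<close> gets mass \<open>2 * \<alpha> - 1\<close>, and
    the fair coin gives \<open>1 - \<alpha>\<close> to each other part. So \<open>x\<close> has mass
    \<open>(2 * \<alpha> - 1) + (1 - \<alpha>) = \<alpha>\<close> in the first marginal, and
    likewise \<open>y\<close> in the second.\<close>
  define \<pi> where "\<pi> = bind_pmf (bernoulli_pmf (2 * \<alpha> - 1)) (\<lambda>b. if b then return_pmf (x, y)
    else bind_pmf (bernoulli_pmf (1 / 2)) (\<lambda>c. if c then map_pmf (\<lambda>z. (z, y)) (P x)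
      else map_pmf (Pair x) (P y)))"
  have P: "pmf (P x) z = lazy_fun G w 0 x z" "pmf (P y) z = lazy_fun G w 0 y z" for z
    unfolding P_def using pmf_lazy_walk[OF G w xy] pmf_lazy_walk[OF G w yx] by simp_all
  have \<alpha>': "0 \<le> 2 * \<alpha> - 1" "2 * \<alpha> - 1 \<le> 1" "0 \<le> \<alpha>" using \<alpha> by auto
  have "map_pmf fst \<pi> = bind_pmf (bernoulli_pmf (2 * \<alpha> - 1)) (\<lambda>b. if b then return_pmf x
    else bind_pmf (bernoulli_pmf (1 / 2)) (\<lambda>c. if c then P x else return_pmf x))"
    unfolding \<pi>_def map_bind_pmf
    by (intro bind_pmf_cong refl) (auto simp: map_bind_pmf map_pmf_comp intro!: bind_pmf_cong)
  also have "\<dots> = lazy_walk G w \<alpha> x"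
    using \<alpha>' \<alpha> by (intro pmf_eqI)
      (simp add: pmf_bind P pmf_lazy_walk[OF G w xy] lazy_fun_mix[where \<alpha> = \<alpha>] indicator_def field_simps)
  finally have 1: "map_pmf fst \<pi> = lazy_walk G w \<alpha> x" .
  have "map_pmf snd \<pi> = bind_pmf (bernoulli_pmf (2 * \<alpha> - 1)) (\<lambda>b. if b then return_pmf y
    else bind_pmf (bernoulli_pmf (1 / 2)) (\<lambda>c. if c then return_pmf y else P y))"
    unfolding \<pi>_def map_bind_pmf
    by (intro bind_pmf_cong refl) (auto simp: map_bind_pmf map_pmf_comp intro!: bind_pmf_cong)
  also have "\<dots> = lazy_walk G w \<alpha> y"
    using \<alpha>' \<alpha> by (intro pmf_eqI)
      (simp add: pmf_bind P pmf_lazy_walk[OF G w yx] lazy_fun_mix[where \<alpha> = \<alpha>] indicator_def field_simps)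
  finally show "\<pi> \<in> couplings (lazy_walk G w \<alpha> x) (lazy_walk G w \<alpha> y)"
    using 1 by (simp add: couplings_def)
  have "set_pmf (P x) \<subseteq> nbrs G x" "set_pmf (P y) \<subseteq> nbrs G y"
    unfolding P_def using set_lazy_walk(2)[OF G w xy] set_lazy_walk(2)[OF G w yx] by auto
  then show "set_pmf \<pi> \<subseteq> insert (x, y) (nbrs G x \<times> {y} \<union> {x} \<times> nbrs G y)"
    by (auto simp: \<pi>_def split: if_splits)
qed

text \<open>The coupling moves mass along paths \<open>u\<close>, \<open>x\<close>,
  \<open>y\<close>, \<open>v\<close>, which are geodesics; a potential dropping by 1 at each step
  certifies that it is optimal.\<close>

lemma kappa_tree_like:
  assumes G: "simple_graph G" "locally_finite G" and w: "positive_weight G w"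
    and e: "{x, y} \<in> tree_like_edges G" and \<alpha>: "1 / 2 \<le> \<alpha>" "\<alpha> \<le> 1"
  shows "kappa G w \<alpha> x y
    = (1 - \<alpha>) * (2 * (w {x, y} / wdeg G w x) + 2 * (w {x, y} / wdeg G w y) - 2)"
proof -
  have xy: "{x, y} \<in> edges G" and yx: "{y, x} \<in> edges G"
    using e by (auto simp: tree_like_edges_def insert_commute)
  have axy: "(x, y) \<in> adj G" and ayx: "(y, x) \<in> adj G" using xy yx by (auto simp: adj_def)
  have ne: "x \<noteq> y" using axy adj_irrefl[OF G(1)] by auto
  have \<alpha>0: "0 \<le> \<alpha>" using \<alpha> by simp
  note irr = adj_irrefl[OF G(1)]
  note tri = tree_like_no_triangle[OF G(1) e]
  \<comment> \<open>The values along a path \<open>u\<close>, \<open>x\<close>, \<open>y\<close>,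
    \<open>v\<close> are 2, 1, 0, -1. The endpoints are tested first because \<open>y\<close> is
    itself a neighbour of \<open>x\<close>.\<close>
  define f :: "'a \<Rightarrow> real" where
    "f z = (if z = x then 1 else if z = y then 0 else if z \<in> nbrs G x then 2 else -1)" for z
  have fN: "f z = 2" if "z \<in> nbrs G x" "z \<noteq> y" for z
    using that irr by (auto simp: f_def in_nbrs_iff)
  \<comment> \<open>No triangle contains the edge, so such a \<open>z\<close> is not a neighbour of
    \<open>x\<close> and reaches the last branch.\<close>
  have fM: "f z = -1" if "z \<in> nbrs G y" "z \<noteq> x" for z
    using that irr tri by (auto simp: f_def in_nbrs_iff)
  have fx: "f x = 1" and fy: "f y = 0" using ne by (auto simp: f_def)
  have finN: "finite (nbrs G x)" "finite (nbrs G y)"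
    using G xy by (auto simp: simple_graph_def locally_finite_def)
  have lip: "f u - f v \<le> real (graph_dist G u v)"
    if u: "u \<in> insert x (nbrs G x)" and v: "v \<in> insert y (nbrs G y)" for u v
  proof -
    have "(u, x) \<in> (adj G)\<^sup>*" using u adj_sym by (fastforce simp: in_nbrs_iff)
    moreover have "(y, v) \<in> (adj G)\<^sup>*" using v by (auto simp: in_nbrs_iff)
    ultimately have "(u, v) \<in> (adj G)\<^sup>*" using axy
      by (meson rtrancl_trans r_into_rtrancl)
    note ge = graph_dist_ge[OF this]
    have le1: "1 \<le> graph_dist G u v" if "u \<noteq> v" using that by (intro ge) auto
    have le2: "2 \<le> graph_dist G u v" if "u \<noteq> v" "(u, v) \<notin> adj G"
      using that by (intro ge) (auto simp: less_2_cases_iff)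
    have le3: "3 \<le> graph_dist G u v" if "u \<noteq> v" "(u, v) \<notin> adj G" "(u, v) \<notin> adj G ^^ 2"
    proof (rule ge)
      fix m :: nat assume "m < 3"
      then have "m = 0 \<or> m = 1 \<or> m = 2" by auto
      then show "(u, v) \<notin> adj G ^^ m" using that by auto
    qed
    \<comment> \<open>The potential drops by 3 only in the last case, which needs the exclusion of
      4- and 5-cycles; a drop of 2 needs only the exclusion of triangles.\<close>
    consider "u = x" "v = y" | "u = x" "v = x" | "u = x" "v \<in> nbrs G y" "v \<noteq> x"
      | "u = y" "v = y" | "u = y" "v = x" | "u = y" "v \<in> nbrs G y" "v \<noteq> x"
      | "u \<in> nbrs G x" "u \<noteq> y" "v = y" | "u \<in> nbrs G x" "u \<noteq> y" "v = x"
      | "u \<in> nbrs G x" "u \<noteq> y" "v \<in> nbrs G y" "v \<noteq> x"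
      using u v by blast
    then show ?thesis
    proof cases
      case 1 then show ?thesis using le1 ne fx fy by simp
    next
      case 2 then show ?thesis by simp
    next
      case 3
      then have "2 \<le> graph_dist G u v" using tri[of v] by (intro le2) (auto simp: in_nbrs_iff)
      then show ?thesis using 3 fx fM by simp
    next
      case 4 then show ?thesis by simp
    next
      case 5 then show ?thesis using fx fy by simp
    next
      case 6
      then have "1 \<le> graph_dist G u v" using irr by (intro le1) (auto simp: in_nbrs_iff)
      then show ?thesis using 6 fy fM by simp
    next
      case 7
      then have "2 \<le> graph_dist G u v" using tri[of u] adj_sym[of u y]
        by (intro le2) (auto simp: in_nbrs_iff)
      then show ?thesis using 7 fy fN by simp
    next
      case 8
      then have "1 \<le> graph_dist G u v" using irr by (intro le1) (auto simp: in_nbrs_iff)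
      then show ?thesis using 8 fx fN by simp
    next
      case 9
      then have "3 \<le> graph_dist G u v" using tree_like_no_short_walk[OF G(1) e]
        by (intro le3) (auto simp: in_nbrs_iff)
      then show ?thesis using 9 fN fM by simp
    qed
  qed
  obtain \<pi> where \<pi>: "\<pi> \<in> couplings (lazy_walk G w \<alpha> x) (lazy_walk G w \<alpha> y)"
    and sub: "set_pmf \<pi> \<subseteq> insert (x, y) (nbrs G x \<times> {y} \<union> {x} \<times> nbrs G y)"
    using lazy_walk_coupling[OF G w xy \<alpha>] by blast
  \<comment> \<open>Explicit walks bound the distance from above. Length 0 occurs for the pairs
    \<open>(y, y)\<close> and \<open>(x, x)\<close>, since each endpoint is a neighbour of the
    other.\<close>
  have tight: "real (graph_dist G u v) = f u - f v" if uv: "(u, v) \<in> set_pmf \<pi>" for u v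
  proof (rule antisym)
    consider "u = x" "v = y" | "u \<in> nbrs G x" "v = y" | "u = x" "v \<in> nbrs G y"
      using sub uv by blast
    then show "real (graph_dist G u v) \<le> f u - f v"
    proof cases
      case 1
      then show ?thesis using graph_dist_le[of x y 1 G] axy fx fy by simp
    next
      case 2
      show ?thesis
      proof (cases "u = y")
        case True
        then show ?thesis using 2 graph_dist_le[of y y 0 G] by simp
      next
        case False
        have "(u, y) \<in> adj G ^^ 2" using 2 axy adj_sym[of u x]
          by (auto simp: numeral_2_eq_2 in_nbrs_iff)
        then show ?thesis using 2 False graph_dist_le[of u y 2 G] fN fy by simp
      qed
    next
      case 3
      show ?thesis
      proof (cases "v = x")
        case True
        then show ?thesis using 3 graph_dist_le[of x x 0 G] by simp
      next
        case False
        have "(x, v) \<in> adj G ^^ 2" using 3 axy by (auto simp: numeral_2_eq_2 in_nbrs_iff)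
        then show ?thesis using 3 False graph_dist_le[of x v 2 G] fM fx by simp
      qed
    qed
    show "f u - f v \<le> real (graph_dist G u v)"
      using sub uv axy ayx by (intro lip) (auto simp: in_nbrs_iff)
  qed
  have "W1 (\<lambda>u v. real (graph_dist G u v)) (lazy_walk G w \<alpha> x) (lazy_walk G w \<alpha> y)
      = measure_pmf.expectation (lazy_walk G w \<alpha> x) f
        - measure_pmf.expectation (lazy_walk G w \<alpha> y) f"
    using set_lazy_walk(1)[OF G w xy \<alpha>0 \<alpha>(2)] set_lazy_walk(1)[OF G w yx \<alpha>0 \<alpha>(2)] finN lip
    by (intro W1_eq_potential[OF _ _ _ \<pi> tight]) (auto intro: finite_subset)
  also have "\<dots> = (\<alpha> * f x + (1 - \<alpha>) * (2 + (f y - 2) * (w {x, y} / wdeg G w x)))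
      - (\<alpha> * f y + (1 - \<alpha>) * (- 1 + (f x - - 1) * (w {y, x} / wdeg G w y)))"
    using expectation_lazy_walk[OF G w xy \<alpha>0 \<alpha>(2) fN] expectation_lazy_walk[OF G w yx \<alpha>0 \<alpha>(2) fM]
    by simp
  finally show ?thesis
    unfolding kappa_def fx fy by (simp add: insert_commute algebra_simps)
qed

text \<open>The factor \<open>1 - \<alpha>\<close> cancels, so the quotient is constant for
  \<open>\<alpha>\<close> between 1/2 and 1 and the limit is its value.\<close>

lemma kappa_LLY_tree_like:
  assumes "simple_graph G" "locally_finite G" "positive_weight G w" "{x, y} \<in> tree_like_edges G"
  shows "kappa_LLY G w x y = 2 * (w {x, y} / wdeg G w x) + 2 * (w {x, y} / wdeg G w y) - 2"
    (is "_ = ?k")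
proof -
  have "\<forall>\<^sub>F \<alpha> in at_left 1. \<alpha> \<in> {1 / 2<..<1::real}"
    by (rule eventually_at_left_real) simp
  then have "\<forall>\<^sub>F \<alpha> in at_left 1. ?k = kappa G w \<alpha> x y / (1 - \<alpha>)"
  proof eventually_elim
    case (elim \<alpha>)
    then show ?case using kappa_tree_like[OF assms, of \<alpha>] by simp
  qed
  then have "((\<lambda>\<alpha>. kappa G w \<alpha> x y / (1 - \<alpha>)) \<longlongrightarrow> ?k) (at_left 1)"
    by (rule tendsto_eventually[OF eventually_mono]) simp
  then show ?thesis unfolding kappa_LLY_def by (intro tendsto_Lim) simp_all
qed

section \<open>Cycles of tree-like edges\<close>

text \<open>Rotation of the cycle indices: it regroups sums over edges by vertices and supplies each
  index with a predecessor.\<close>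

lemma bij_betw_Suc_mod: "bij_betw (\<lambda>i. Suc i mod n) {..<n} {..<n}"
proof -
  have "inj_on (\<lambda>i. Suc i mod n) {..<n}"
    by (auto simp: inj_on_def mod_Suc split: if_splits)
  moreover have "(\<lambda>i. Suc i mod n) ` {..<n} \<subseteq> {..<n}" by auto
  ultimately show ?thesis by (simp add: bij_betw_def endo_inj_surj)
qed

text \<open>Stated at \<open>c ! s i\<close>, so that the preceding vertex is \<open>c ! i\<close>
  and no modular subtraction arises.\<close>

lemma degree_two_on_tree_like_cycle:
  assumes G: "simple_graph G" "locally_finite G" and w: "admissible G w"
    and c: "is_cycle (skeleton G) c" and i: "i < length c"
  defines "s \<equiv> \<lambda>i. Suc i mod length c"
  shows "nbrs G (c ! s i) = {c ! i, c ! s (s i)}"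
proof -
  let ?n = "length c"
  have n: "3 \<le> ?n" and dist: "distinct c" and ce: "cycle_edges c \<subseteq> tree_like_edges G"
    using c by (auto simp: is_cycle_def skeleton_def)
  have pw: "positive_weight G w" using w by (simp add: admissible_def)
  have s_lt: "s j < ?n" if "j < ?n" for j
    unfolding s_def using that by (intro mod_less_divisor) auto
  define W where "W j = w {c ! j, c ! s j}" for j
  define D where "D j = wdeg G w (c ! j)" for j
  have tl: "{c ! j, c ! s j} \<in> tree_like_edges G" if "j < ?n" for j
    using ce that by (auto simp: cycle_edges_def s_def)
  then have ed: "{c ! j, c ! s j} \<in> edges G" if "j < ?n" for j
    using that by (auto simp: tree_like_edges_def)
  have Dpos: "0 < D j" if "j < ?n" for j
    unfolding D_def using wdeg_pos[OF G pw ed[OF that]] .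
  have curv: "1 \<le> W j / D j + W j / D (s j)" if "j < ?n" for j
  proof -
    have "0 \<le> kappa_LLY G w (c ! j) (c ! s j)" using w ed[OF that] by (simp add: admissible_def)
    then show ?thesis
      unfolding kappa_LLY_tree_like[OF G pw tl[OF that]] W_def D_def by linarith
  qed
  have sub: "{c ! j, c ! s (s j)} \<subseteq> nbrs G (c ! s j)" if "j < ?n" for j
    using ed[OF that] ed[OF s_lt[OF that]] by (auto simp: nbrs_def adj_def insert_commute)
  have fin: "finite (nbrs G (c ! s j))" if "j < ?n" for j
    using G ed[OF that] by (auto simp: simple_graph_def locally_finite_def)
  \<comment> \<open>Length at least 3 separates the predecessor from the successor, so the two cycle
    edges at a vertex are counted separately.\<close>
  have ne: "c ! j \<noteq> c ! s (s j)" if "j < ?n" for j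
    using n that dist s_lt[OF s_lt[OF that]]
    by (auto simp: nth_eq_iff_index_eq s_def mod_Suc split: if_splits)
  have pos: "0 < w {c ! s j, z}" if "z \<in> nbrs G (c ! s j)" for j z
    using that pw by (auto simp: positive_weight_def nbrs_def adj_def)
  have two: "(\<Sum>z\<in>{c ! j, c ! s (s j)}. w {c ! s j, z}) = W j + W (s j)" if "j < ?n" for j
    using ne[OF that] by (simp add: W_def insert_commute)
  have le: "W j + W (s j) \<le> D (s j)" if "j < ?n" for j
    unfolding two[OF that, symmetric] D_def wdeg_def
    using sub[OF that] fin[OF that] less_imp_le[OF pos] by (intro sum_mono2) auto
  \<comment> \<open>Shifting this half of the curvature sum gives both halves the denominator
    \<open>D (s j)\<close>.\<close>
  have reg: "(\<Sum>j<?n. W j / D j) = (\<Sum>j<?n. W (s j) / D (s j))"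
    unfolding s_def by (rule sum.reindex_bij_betw[OF bij_betw_Suc_mod, symmetric])
  \<comment> \<open>Each vertex contributes at most 1 to a sum that is at least the length; strict
    inequality at one vertex would make the length less than itself.\<close>
  have "W i + W (s i) = D (s i)"
  proof (rule ccontr)
    assume "W i + W (s i) \<noteq> D (s i)"
    then have lt: "W i + W (s i) < D (s i)" using le[OF i] by simp
    have "(\<Sum>j<?n. 1) \<le> (\<Sum>j<?n. W j / D j + W j / D (s j))"
      using curv by (intro sum_mono) auto
    also have "\<dots> = (\<Sum>j<?n. (W j + W (s j)) / D (s j))"
      by (simp add: sum.distrib reg add_divide_distrib)
    also have "\<dots> < (\<Sum>j<?n. 1)"
      using lt i le Dpos[OF s_lt] by (intro sum_strict_mono_ex1) (auto intro!: bexI[of _ i])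
    finally show False by simp
  qed
  show ?thesis
  proof (rule ccontr)
    assume "nbrs G (c ! s i) \<noteq> {c ! i, c ! s (s i)}"
    then obtain z where z: "z \<in> nbrs G (c ! s i)" "z \<notin> {c ! i, c ! s (s i)}"
      using sub[OF i] by blast
    have "W i + W (s i) < D (s i)"
      unfolding two[OF i, symmetric] D_def wdeg_def
      using sub[OF i] fin[OF i] z pos less_imp_le[OF pos]
      by (intro sum_strict_mono2[of _ _ z]) auto
    then show False using \<open>W i + W (s i) = D (s i)\<close> by simp
  qed
qed

section \<open>From the tree-like cycle to the whole graph\<close>

text \<open>The isomorphism sends a vertex to its position in the list.\<close>

lemma graph_iso_cycle_graph:
  assumes "distinct c" "verts G = set c" "edges G = cycle_edges c"
  shows "graph_iso G (cycle_graph (length c))"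
proof -
  let ?n = "length c" and ?g = "\<lambda>i. c ! i"
  let ?f = "the_inv_into {..<?n} ?g"
  have bij: "bij_betw ?g {..<?n} (set c)" using assms(1) by (rule bij_betw_nth) auto
  have f: "?f (c ! i) = i" if "i < ?n" for i
    using bij that by (intro the_inv_into_f_f) (auto simp: bij_betw_def)
  have "?f ` {c ! i, c ! (Suc i mod ?n)} = {[0..<?n] ! i, [0..<?n] ! (Suc i mod ?n)}"
    if "i < ?n" for i
  proof -
    have "Suc i mod ?n < ?n" using that by (intro mod_less_divisor) auto
    then show ?thesis using that f by simp
  qed
  then have "(`) ?f ` cycle_edges c = cycle_edges [0..<?n]"
    unfolding cycle_edges_def image_image by (intro image_cong) simp_all
  moreover have "bij_betw ?f (set c) {..<?n}" using bij by (rule bij_betw_the_inv_into)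
  ultimately show ?thesis
    unfolding graph_iso_def cycle_graph_def using assms by auto
qed

theorem theorem1p1:
  fixes G :: "'a ugraph"
  assumes "simple_graph G" and "locally_finite G" and "connected_graph G"
    and "DN_LLY G < \<infinity>"
  shows "(\<exists>n\<ge>6. graph_iso G (cycle_graph n)) \<or> forest (skeleton G)"
proof (cases "forest (skeleton G)")
  case False
  then obtain c where c: "is_cycle (skeleton G) c" by (auto simp: forest_def)
  let ?n = "length c" and ?s = "\<lambda>i. Suc i mod length c"
  have n3: "3 \<le> ?n" and dist: "distinct c" and ce: "cycle_edges c \<subseteq> tree_like_edges G"
    using c by (auto simp: is_cycle_def skeleton_def)
  have ceG: "cycle_edges c \<subseteq> edges G" using ce by (auto simp: tree_like_edges_def)
  have inE: "{c ! i, c ! ?s i} \<in> cycle_edges c" if "i < ?n" for i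
    using that by (auto simp: cycle_edges_def)
  have cV: "set c \<subseteq> verts G"
    using inE ceG assms(1) by (fastforce simp: in_set_conv_nth simple_graph_def)
  \<comment> \<open>A shorter cycle in the skeleton would be a cycle of \<open>G\<close> that keeps
    its own edges from being tree-like.\<close>
  have n6: "6 \<le> ?n"
  proof (rule ccontr)
    assume "\<not> 6 \<le> ?n"
    moreover have "is_cycle G c" using n3 dist ceG by (simp add: is_cycle_def)
    ultimately show False
      using tree_like_not_in_short_cycle inE[of 0] ce n3 by fastforce
  qed
  have "card (verts G) \<noteq> 1"
  proof
    assume 1: "card (verts G) = 1"
    then have "card (set c) \<le> 1" using card_mono[OF _ cV] card.infinite by fastforce
    then show False using dist n3 by (simp add: distinct_card)
  qed
  then have "(INF w\<in>{w. admissible G w}. Dist G w) < \<infinity>"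
    using assms(4) by (simp add: DN_LLY_def)
  \<comment> \<open>An infimum over the empty set would be infinite.\<close>
  then obtain w where w: "admissible G w"
    by (cases "{w. admissible G w} = {}") (auto simp: top_ereal_def)
  have nb: "nbrs G (c ! ?s i) = {c ! i, c ! ?s (?s i)}" if "i < ?n" for i
    using degree_two_on_tree_like_cycle[OF assms(1,2) w c that] .
  \<comment> \<open>The cycle is closed under adjacency and chordless: both neighbours of a cycle
    vertex are reached by cycle edges.\<close>
  have edge: "{a, b} \<in> cycle_edges c \<and> b \<in> set c" if "a \<in> set c" "(a, b) \<in> adj G" for a b
  proof -
    obtain j where j: "j < ?n" "a = c ! j" using \<open>a \<in> set c\<close> by (auto simp: in_set_conv_nth)
    from j(1) have "j \<in> ?s ` {..<?n}"
      by (simp add: bij_betw_imp_surj_on[OF bij_betw_Suc_mod])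
    then obtain i where i: "i < ?n" "a = c ! ?s i" using j(2) by blast
    have "b \<in> {c ! i, c ! ?s (?s i)}" using nb[OF i(1)] that(2) i(2) by (auto simp: nbrs_def)
    moreover have lt: "?s m < ?n" for m by (rule mod_less_divisor) (use n3 in linarith)
    ultimately show ?thesis
      using inE[OF i(1)] inE[OF lt[of i]] i nth_mem[OF i(1)] nth_mem[OF lt[of "?s i"]]
      by (auto simp: insert_commute)
  qed
  have c0: "c ! 0 \<in> set c" using n3 by (intro nth_mem) linarith
  \<comment> \<open>By connectedness, closure under adjacency carries membership along a walk from
    \<open>c ! 0\<close> to every vertex.\<close>
  have "v \<in> set c" if "v \<in> verts G" for v
  proof -
    have "(c ! 0, v) \<in> (adj G)\<^sup>*"
      using assms(3) that c0 cV by (auto simp: connected_graph_def)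
    then show ?thesis by (induction rule: rtrancl_induct) (use c0 edge in auto)
  qed
  then have V: "verts G = set c" using cV by auto
  have "edges G \<subseteq> cycle_edges c"
  proof
    fix e assume e: "e \<in> edges G"
    then obtain a b where "e = {a, b}" "a \<in> verts G"
      using assms(1) by (fastforce simp: simple_graph_def card_2_iff)
    then show "e \<in> cycle_edges c" using edge[of a b] e V by (auto simp: adj_def)
  qed
  then have "graph_iso G (cycle_graph ?n)"
    using graph_iso_cycle_graph[OF dist V] ceG by blast
  then show ?thesis using n6 by blast
qed simp

end
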